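(* Let $D$ be an $m$-colored $3$-quasi-transitive digraph. Then $D$ has a $k$-colored kernel for every integer $k\geq 4$.
   Context: Digraphs are finite, nonempty, without loops or parallel arcs (pairs of opposite arcs are allowed); $V(D)$ and $A(D)$ denote the vertex and arc sets of $D$. A digraph $D$ is $3$-quasi-transitive if whenever $u_0,u_1,u_2,u_3$ are distinct vertices with $(u_0,u_1),(u_1,u_2),(u_2,u_3)\in A(D)$, at least one of $(u_0,u_3)$, $(u_3,u_0)$ is in $A(D)$. A digraph $D$ is $m$-colored ($m$ a positive integer) if its arcs are colored with $m$ colors (each arc receives one color; no properness condition). Directed paths have no repeated vertices. For a positive integer $j$, a directed path is $j$-colored if its arcs use exactly $j$ colors; $u\leadsto_j v$ denotes a $j$-colored directed path from $u$ to $v$. For a positive integer $k$, a nonempty set $K\subseteq V(D)$ is a $k$-colored kernel of $D$ if it is both: (a) $k$-colored absorbent: for every $u\in V(D)\setminus K$ there exist $v\in K$ and $1\leq j\leq k$ with a path $u\leadsto_j v$ in $D$; and (b) $k$-colored independent: for all distinct $u,v\in K$ there is no path $u\leadsto_j v$ with $1\leq j\leq k$. *)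

theory Defs
  imports "Graph_Theory.Digraph" "Graph_Theory.Arc_Walk"
begin

definition three_quasi_transitive :: "('a, 'b) pre_digraph \<Rightarrow> bool" where
  "three_quasi_transitive D \<longleftrightarrow>
     (\<forall>u0 u1 u2 u3. distinct [u0, u1, u2, u3] \<and>
        (u0, u1) \<in> arcs_ends D \<and> (u1, u2) \<in> arcs_ends D \<and> (u2, u3) \<in> arcs_ends D \<longrightarrow>
        (u0, u3) \<in> arcs_ends D \<or> (u3, u0) \<in> arcs_ends D)"

text \<open>The colours are \<open>1, \<dots>, m\<close>; not every colour has to occur on an arc.\<close>

definition arc_colored :: "('a, 'b) pre_digraph \<Rightarrow> nat \<Rightarrow> ('b \<Rightarrow> nat) \<Rightarrow> bool" where
  "arc_colored D m c \<longleftrightarrow> m \<ge> 1 \<and> (\<forall>e \<in> arcs D. c e \<in> {1..m})"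

definition colored_path ::
  "('a, 'b) pre_digraph \<Rightarrow> ('b \<Rightarrow> nat) \<Rightarrow> nat \<Rightarrow> 'a \<Rightarrow> 'b awalk \<Rightarrow> 'a \<Rightarrow> bool" where
  "colored_path D c j u p v \<longleftrightarrow> pre_digraph.apath D u p v \<and> card (c ` set p) = j"

definition colored_absorbent ::
  "('a, 'b) pre_digraph \<Rightarrow> ('b \<Rightarrow> nat) \<Rightarrow> nat \<Rightarrow> 'a set \<Rightarrow> bool" where
  "colored_absorbent D c k K \<longleftrightarrow>
     (\<forall>u \<in> verts D - K. \<exists>v \<in> K. \<exists>j p. 1 \<le> j \<and> j \<le> k \<and> colored_path D c j u p v)"

definition colored_independent ::
  "('a, 'b) pre_digraph \<Rightarrow> ('b \<Rightarrow> nat) \<Rightarrow> nat \<Rightarrow> 'a set \<Rightarrow> bool" where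
  "colored_independent D c k K \<longleftrightarrow>
     (\<forall>u \<in> K. \<forall>v \<in> K. u \<noteq> v \<longrightarrow> \<not> (\<exists>j p. 1 \<le> j \<and> j \<le> k \<and> colored_path D c j u p v))"

definition colored_kernel ::
  "('a, 'b) pre_digraph \<Rightarrow> ('b \<Rightarrow> nat) \<Rightarrow> nat \<Rightarrow> 'a set \<Rightarrow> bool" where
  "colored_kernel D c k K \<longleftrightarrow>
     K \<noteq> {} \<and> K \<subseteq> verts D \<and> colored_absorbent D c k K \<and> colored_independent D c k K"

end

theory Submission
  imports Defs
begin

text \<open>
  A \<open>k\<close>-coloured kernel of \<open>D\<close> is a kernel, in the ordinary sense, of the closure relation \<open>T\<close> in
  which \<open>T u v\<close> holds when some directed path from \<open>u\<close> to \<open>v\<close> uses at most \<open>k\<close> colours. A finite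
  relation has a kernel as soon as its one-way pairs (\<open>T u v\<close> but not \<open>T v u\<close>) form no directed
  cycle: see \<open>kernel_if_acyclic_asymmetric_part\<close>. The colouring enters only through the remark that
  a walk of length at most \<open>4 \<le> k\<close> contains a path with at most \<open>k\<close> colours, so a one-way pair
  \<open>(u, v)\<close> has no walk of length at most four from \<open>v\<close> back to \<open>u\<close>. The rest is a statement about
  distances in an uncoloured \<open>3\<close>-quasi-transitive digraph.

  \<^item> If \<open>v\<close> is at finite distance at least three from \<open>u\<close>, then \<open>u\<close> is at distance at most four from
    \<open>v\<close> (\<open>dist_le_two_or_back_dist_le_four\<close>). Hence a one-way pair \<open>(u, v)\<close> has distance at most two.
  \<^item> Distance at most two is preserved by one-way pairs: if \<open>u\<close> is within two of \<open>x\<close>, if \<open>w\<close> is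
    within two of \<open>u\<close>, and if \<open>u\<close> is not within four of \<open>w\<close>, then \<open>w\<close> is within two of \<open>x\<close>
    (\<open>dist_le_two_step\<close>).

  Along a cycle of one-way pairs starting at \<open>x\<close>, every vertex is therefore within two of \<open>x\<close>. This
  includes the last vertex \<open>y\<close> before the cycle closes, so \<open>T x y\<close> holds, although \<open>(y, x)\<close> is a
  one-way pair.
\<close>

section \<open>Kernels of finite relations\<close>

text \<open>
  Acyclicity gives a vertex \<open>z\<close> with no outgoing one-way pair, so that everything \<open>z\<close> reaches also
  reaches \<open>z\<close>. Put \<open>z\<close> into the kernel, discard the vertices that \<open>z\<close> absorbs, and recurse on the
  rest: what remains neither reaches \<open>z\<close> nor, by the choice of \<open>z\<close>, is reached from it.
\<close>

lemma kernel_if_acyclic_asymmetric_part: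
  assumes "finite V"
    and "acyclic {(u, v). u \<in> V \<and> v \<in> V \<and> T u v \<and> \<not> T v u}"
  shows "\<exists>K \<subseteq> V. (\<forall>u \<in> V - K. \<exists>v \<in> K. T u v) \<and> (\<forall>u \<in> K. \<forall>v \<in> K. u \<noteq> v \<longrightarrow> \<not> T u v)"
  using assms
proof (induction V rule: finite_psubset_induct)
  case (psubset V)
  let ?A = "\<lambda>V. {(u, v). u \<in> V \<and> v \<in> V \<and> T u v \<and> \<not> T v u}"
  show ?case
  proof (cases "V = {}")
    case True
    then show ?thesis by auto
  next
    case False
    then obtain a where a: "a \<in> V" by blast
    have "finite (?A V)"
      by (rule finite_subset[of _ "V \<times> V"]) (use psubset.hyps in auto)
    then have "wf ((?A V)\<inverse>)"
      using psubset.prems by (rule finite_acyclic_wf_converse)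
    then obtain z where z: "z \<in> V" and z_min: "\<And>y. (y, z) \<in> (?A V)\<inverse> \<Longrightarrow> y \<notin> V"
      using a by (rule wfE_min) blast
    have sink: "T x z" if "x \<in> V" "T z x" for x
      using z_min[of x] z that by auto
    let ?W = "{x \<in> V. x \<noteq> z \<and> \<not> T x z}"
    have "?W \<subset> V" using z by auto
    moreover have "acyclic (?A ?W)"
      by (rule acyclic_subset[OF psubset.prems]) auto
    ultimately obtain K where "K \<subseteq> ?W" "\<forall>u \<in> ?W - K. \<exists>v \<in> K. T u v"
      "\<forall>u \<in> K. \<forall>v \<in> K. u \<noteq> v \<longrightarrow> \<not> T u v"
      using psubset.IH[of ?W] by blast
    then have "insert z K \<subseteq> V" "\<forall>u \<in> V - insert z K. \<exists>v \<in> insert z K. T u v"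
      "\<forall>u \<in> insert z K. \<forall>v \<in> insert z K. u \<noteq> v \<longrightarrow> \<not> T u v"
      using z sink by blast+
    then show ?thesis by blast
  qed
qed

section \<open>Distances in 3-quasi-transitive digraphs\<close>

definition dist_le :: "('a, 'b) pre_digraph \<Rightarrow> nat \<Rightarrow> 'a \<Rightarrow> 'a \<Rightarrow> bool" where
  "dist_le D n u v \<longleftrightarrow> (\<exists>i \<le> n. (u, v) \<in> arcs_ends D ^^ i)"

lemma dist_le_refl: "dist_le D n u u"
  unfolding dist_le_def by (rule exI[of _ 0]) simp

lemma dist_le_Suc: "u \<rightarrow>\<^bsub>D\<^esub> v \<Longrightarrow> dist_le D n v w \<Longrightarrow> dist_le D (Suc n) u w"
  unfolding dist_le_def by (meson Suc_le_mono relpow_Suc_I2)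

lemma dist_le_mono: "dist_le D n u v \<Longrightarrow> n \<le> n' \<Longrightarrow> dist_le D n' u v"
  unfolding dist_le_def using le_trans by blast

lemma dist_le_arc: "u \<rightarrow>\<^bsub>D\<^esub> v \<Longrightarrow> dist_le D (Suc n) u v"
  by (rule dist_le_Suc[OF _ dist_le_refl])

lemma dist_le_two_iff:
  "dist_le D 2 u v \<longleftrightarrow> u = v \<or> u \<rightarrow>\<^bsub>D\<^esub> v \<or> (\<exists>a. u \<rightarrow>\<^bsub>D\<^esub> a \<and> a \<rightarrow>\<^bsub>D\<^esub> v)"
proof -
  have "(\<exists>i \<le> 2. P i) \<longleftrightarrow> P 0 \<or> P 1 \<or> P 2" for P :: "nat \<Rightarrow> bool"
    by (metis One_nat_def Suc_1 le_SucE le_Suc_eq le_zero_eq order_refl zero_le)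
  then show ?thesis
    unfolding dist_le_def by (auto simp: numeral_2_eq_2)
qed

text \<open>
  A walk of length three with ends at distance at least three has four distinct vertices, so
  \<open>3\<close>-quasi-transitivity applies to it and can only supply the backward arc.
\<close>

lemma back_arc_of_distance_three:
  assumes "three_quasi_transitive D" "x \<rightarrow>\<^bsub>D\<^esub> a" "a \<rightarrow>\<^bsub>D\<^esub> b" "b \<rightarrow>\<^bsub>D\<^esub> y" "\<not> dist_le D 2 x y"
  shows "y \<rightarrow>\<^bsub>D\<^esub> x"
proof -
  have "distinct [x, a, b, y]" "\<not> x \<rightarrow>\<^bsub>D\<^esub> y"
    using assms(2-5) unfolding dist_le_two_iff by auto
  then show ?thesis
    using assms(1-4) unfolding three_quasi_transitive_def by blast
qed

text \<open>
  On a geodesic \<open>u \<rightarrow> a \<rightarrow> b \<rightarrow> y \<rightarrow> \<dots> \<rightarrow> v\<close> of odd length at least five, the geodesic from \<open>b\<close> to \<open>v\<close>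
  is two shorter and inductively gives \<open>v \<rightarrow> b\<close>, while the first three arcs give \<open>y \<rightarrow> u\<close>. Then
  \<open>v \<rightarrow> b \<rightarrow> y \<rightarrow> u\<close> is a path, which forces \<open>v \<rightarrow> u\<close>.
\<close>

lemma back_arc_of_odd_distance:
  assumes "three_quasi_transitive D"
    and "(u, v) \<in> arcs_ends D ^^ (2 * n + 3)" "\<not> dist_le D (2 * n + 2) u v"
  shows "v \<rightarrow>\<^bsub>D\<^esub> u"
  using assms(2,3)
proof (induction n arbitrary: u)
  case 0
  then obtain a b where "u \<rightarrow>\<^bsub>D\<^esub> a" "a \<rightarrow>\<^bsub>D\<^esub> b" "b \<rightarrow>\<^bsub>D\<^esub> v"
    by (auto simp: numeral_3_eq_3 relcomp_unfold)
  moreover have "\<not> dist_le D 2 u v" using 0(2) by (simp add: numeral_2_eq_2)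
  ultimately show ?case by (rule back_arc_of_distance_three[OF assms(1)])
next
  case (Suc n)
  have "(u, v) \<in> arcs_ends D ^^ Suc (Suc (Suc (2 * n + 2)))"
    using Suc.prems(1) by (simp add: eval_nat_numeral)
  then obtain a b y where ua: "u \<rightarrow>\<^bsub>D\<^esub> a" and ab: "a \<rightarrow>\<^bsub>D\<^esub> b" and by_: "b \<rightarrow>\<^bsub>D\<^esub> y"
    and yv: "(y, v) \<in> arcs_ends D ^^ (2 * n + 2)"
    by (metis relpow_Suc_D2)
  have far: "\<not> dist_le D (Suc (Suc (2 * n + 2))) u v"
    using Suc.prems(2) by simp
  have "\<not> dist_le D (2 * n + 2) b v"
    using far dist_le_Suc[OF ua dist_le_Suc[OF ab]] by blast
  moreover have "(b, v) \<in> arcs_ends D ^^ (2 * n + 3)"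
    using relpow_Suc_I2[OF by_ yv] by (simp add: eval_nat_numeral)
  ultimately have vb: "v \<rightarrow>\<^bsub>D\<^esub> b" and bv: "b \<noteq> v"
    using Suc.IH dist_le_refl by metis+
  have uy: "\<not> dist_le D 2 u y"
  proof
    assume "dist_le D 2 u y"
    then obtain i where i: "i \<le> 2" "(u, y) \<in> arcs_ends D ^^ i"
      unfolding dist_le_def by blast
    then have "(u, v) \<in> arcs_ends D ^^ (i + (2 * n + 2))"
      using yv by (auto simp: relpow_add)
    moreover have "i + (2 * n + 2) \<le> Suc (Suc (2 * n + 2))" using i by simp
    ultimately show False using far unfolding dist_le_def by blast
  qed
  then have yu: "y \<rightarrow>\<^bsub>D\<^esub> u"
    using back_arc_of_distance_three[OF assms(1) ua ab by_] by blast
  have "\<not> u \<rightarrow>\<^bsub>D\<^esub> v" "u \<noteq> v"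
    using far dist_le_arc dist_le_refl by metis+
  moreover have "v \<noteq> y"
  proof
    assume "v = y"
    then have "dist_le D (Suc (Suc (Suc 0))) u v"
      using dist_le_Suc[OF ua dist_le_Suc[OF ab dist_le_arc[OF by_]]] by simp
    then show False using far dist_le_mono by (metis Suc_le_mono le_add2 le0 add_2_eq_Suc')
  qed
  moreover have "b \<noteq> y" "b \<noteq> u" "y \<noteq> u"
    using uy ua ab by_ unfolding dist_le_two_iff by auto
  ultimately have "distinct [v, b, y, u]" using bv by auto
  then have "v \<rightarrow>\<^bsub>D\<^esub> u \<or> u \<rightarrow>\<^bsub>D\<^esub> v"
    using assms(1) vb by_ yu unfolding three_quasi_transitive_def by blast
  then show ?case using \<open>\<not> u \<rightarrow>\<^bsub>D\<^esub> v\<close> by blast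
qed

text \<open>
  Odd distances give an arc back. On a geodesic \<open>u \<rightarrow> a \<rightarrow> b \<rightarrow> y \<rightarrow> \<dots> \<rightarrow> v\<close> of even length at least
  four, the odd case applied from \<open>a\<close> gives \<open>v \<rightarrow> a\<close>, and one returns by \<open>v \<rightarrow> a \<rightarrow> b \<rightarrow> y \<rightarrow> u\<close>.
\<close>

lemma dist_le_two_or_back_dist_le_four:
  assumes "three_quasi_transitive D" "(u, v) \<in> (arcs_ends D)\<^sup>*"
  shows "dist_le D 2 u v \<or> dist_le D 4 v u"
proof (rule ccontr)
  assume contra: "\<not> ?thesis"
  define n where "n = (LEAST n. (u, v) \<in> arcs_ends D ^^ n)"
  have n: "(u, v) \<in> arcs_ends D ^^ n"
    unfolding n_def using assms(2) by (metis LeastI rtrancl_power)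
  have least: "\<not> dist_le D i u v" if "i < n" for i
    using that not_less_Least unfolding dist_le_def n_def by (metis le_less_trans)
  have "n > 2"
    using contra n unfolding dist_le_def by (meson not_le)
  show False
  proof (cases "odd n")
    case True
    then obtain j where "n = 2 * j + 3"
    proof -
      from True obtain i where "n = 2 * i + 1" by (auto elim: oddE)
      then have "n = 2 * (i - 1) + 3" using \<open>n > 2\<close> by simp
      then show ?thesis by (rule that)
    qed
    then have "v \<rightarrow>\<^bsub>D\<^esub> u"
      using back_arc_of_odd_distance[OF assms(1)] n least[of "2 * j + 2"] by simp
    then show False
      using contra dist_le_arc[of v u D 3] by simp
  next
    case False
    then obtain j where j: "n = Suc (2 * j + 3)"
    proof -
      from False obtain i where "n = 2 * i" by (auto elim: evenE)
      then have "n = Suc (2 * (i - 2) + 3)" using \<open>n > 2\<close> by simp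
      then show ?thesis by (rule that)
    qed
    then have "(u, v) \<in> arcs_ends D ^^ Suc (Suc (Suc (2 * j + 1)))"
      using n by (simp add: eval_nat_numeral)
    then obtain a b y where ua: "u \<rightarrow>\<^bsub>D\<^esub> a" and ab: "a \<rightarrow>\<^bsub>D\<^esub> b" and by_: "b \<rightarrow>\<^bsub>D\<^esub> y"
      and yv: "(y, v) \<in> arcs_ends D ^^ (2 * j + 1)"
      by (metis relpow_Suc_D2)
    have "(a, v) \<in> arcs_ends D ^^ (2 * j + 3)"
      using relpow_Suc_I2[OF ab relpow_Suc_I2[OF by_ yv]] by (simp add: eval_nat_numeral)
    moreover have "\<not> dist_le D (2 * j + 2) a v"
      using dist_le_Suc[OF ua] least[of "Suc (2 * j + 2)"] j by auto
    ultimately have va: "v \<rightarrow>\<^bsub>D\<^esub> a"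
      by (rule back_arc_of_odd_distance[OF assms(1)])
    have "\<not> dist_le D 2 u y"
    proof
      assume "dist_le D 2 u y"
      then obtain i where i: "i \<le> 2" "(u, y) \<in> arcs_ends D ^^ i"
        unfolding dist_le_def by blast
      then have "(u, v) \<in> arcs_ends D ^^ (i + (2 * j + 1))"
        using yv by (auto simp: relpow_add)
      moreover have "i + (2 * j + 1) < n" using i j by simp
      ultimately show False using least unfolding dist_le_def by blast
    qed
    then have "y \<rightarrow>\<^bsub>D\<^esub> u"
      by (rule back_arc_of_distance_three[OF assms(1) ua ab by_])
    then have "dist_le D 4 v u"
      using dist_le_Suc[OF va dist_le_Suc[OF ab dist_le_Suc[OF by_ dist_le_arc[of y u D 0]]]]
      by (simp add: eval_nat_numeral)
    then show False using contra by blast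
  qed
qed

text \<open>
  If \<open>w\<close> were not within two of \<open>x\<close>, it would be at distance three or four. At distance three the arc
  \<open>w \<rightarrow> x\<close> returns from \<open>w\<close> to \<open>u\<close> in at most three steps. At distance four, \<open>u\<close> is the midpoint of
  a geodesic \<open>x \<rightarrow> a \<rightarrow> u \<rightarrow> b \<rightarrow> w\<close>, and the arc \<open>w \<rightarrow> a\<close> returns to \<open>u\<close> in two steps.
\<close>

lemma dist_le_two_step:
  assumes "three_quasi_transitive D"
    and xu: "dist_le D 2 x u" and uw: "dist_le D 2 u w" and wu: "\<not> dist_le D 4 w u"
  shows "dist_le D 2 x w"
proof (rule ccontr)
  assume far: "\<not> dist_le D 2 x w"
  have "\<not> w \<rightarrow>\<^bsub>D\<^esub> x"
  proof
    assume "w \<rightarrow>\<^bsub>D\<^esub> x"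
    then show False
      using dist_le_Suc[OF _ xu] dist_le_mono[of D "Suc 2" w u 4] wu by fastforce
  qed
  then have no3: "False" if "x \<rightarrow>\<^bsub>D\<^esub> p" "p \<rightarrow>\<^bsub>D\<^esub> q" "q \<rightarrow>\<^bsub>D\<^esub> w" for p q
    using back_arc_of_distance_three[OF assms(1) that far] by blast
  have "x \<noteq> u" using uw far by auto
  have "u \<noteq> w" using xu far by auto
  obtain a b where xa: "x \<rightarrow>\<^bsub>D\<^esub> a" and au: "a \<rightarrow>\<^bsub>D\<^esub> u" and ub: "u \<rightarrow>\<^bsub>D\<^esub> b" and bw: "b \<rightarrow>\<^bsub>D\<^esub> w"
    using xu uw far no3 \<open>x \<noteq> u\<close> \<open>u \<noteq> w\<close> unfolding dist_le_two_iff by blast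
  have "\<not> dist_le D 2 a w"
    using no3 xa far unfolding dist_le_two_iff by blast
  then have "w \<rightarrow>\<^bsub>D\<^esub> a"
    by (rule back_arc_of_distance_three[OF assms(1) au ub bw])
  then have "dist_le D 2 w u"
    using au unfolding dist_le_two_iff by blast
  then show False using wu dist_le_mono by fastforce
qed

section \<open>Walks and coloured paths\<close>

lemma (in wf_digraph) awalk_of_relpow:
  assumes "(u, v) \<in> arcs_ends G ^^ n" "u \<in> verts G"
  shows "\<exists>p. awalk u p v \<and> length p = n"
  using assms
proof (induction n arbitrary: u)
  case 0
  then show ?case by (auto simp: awalk_Nil_iff)
next
  case (Suc n)
  then obtain w where "u \<rightarrow>\<^bsub>G\<^esub> w" "(w, v) \<in> arcs_ends G ^^ n"
    by (metis relpow_Suc_D2)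
  then obtain e where e: "e \<in> arcs G" "tail G e = u" "head G e = w"
    by (auto simp: arcs_ends_conv)
  then obtain p where "awalk w p v" "length p = n"
    using Suc.IH \<open>(w, v) \<in> arcs_ends G ^^ n\<close> by (metis head_in_verts)
  then have "awalk u (e # p) v \<and> length (e # p) = Suc n"
    using e by (simp add: awalk_Cons_iff)
  then show ?case by blast
qed

lemma (in wf_digraph) colored_path_if_dist_le:
  assumes "dist_le G n u v" "u \<in> verts G" "u \<noteq> v"
  shows "\<exists>j p. 1 \<le> j \<and> j \<le> n \<and> colored_path G c j u p v"
proof -
  obtain q where q: "awalk u q v" "length q \<le> n"
    using assms awalk_of_relpow unfolding dist_le_def by blast
  let ?p = "awalk_to_apath q"
  have p: "apath u ?p v" using q(1) by (rule apath_awalk_to_apath)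
  have "?p \<noteq> []" using p assms(3) by (metis apath_Nil_iff)
  then have "1 \<le> card (c ` set ?p)"
    by (simp add: Suc_le_eq card_gt_0_iff)
  moreover have "card (c ` set ?p) \<le> card (c ` set q)"
    using awalk_to_apath_subset[OF q(1)] by (intro card_mono image_mono) auto
  then have "card (c ` set ?p) \<le> n"
    using card_image_le[of "set q" c] card_length[of q] q(2) by simp
  ultimately show ?thesis
    using p unfolding colored_path_def by blast
qed

lemma (in wf_digraph) rtrancl_if_colored_path:
  "colored_path G c j u p v \<Longrightarrow> (u, v) \<in> (arcs_ends G)\<^sup>*"
  unfolding colored_path_def by (metis awalkI_apath reachable_awalkI reachable_rtranclI)

section \<open>The coloured kernel\<close>

theorem theorem16:
  fixes D :: "('a, 'b) pre_digraph" and c :: "'b \<Rightarrow> nat" and m k :: nat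
  assumes "digraph D" and "verts D \<noteq> {}"
    and "arc_colored D m c"
    and "three_quasi_transitive D"
    and "k \<ge> 4"
  shows "\<exists>K. colored_kernel D c k K"
proof -
  interpret digraph D by (rule assms(1))
  define T where "T u v \<longleftrightarrow> (\<exists>j p. 1 \<le> j \<and> j \<le> k \<and> colored_path D c j u p v)" for u v
  let ?A = "{(u, v). u \<in> verts D \<and> v \<in> verts D \<and> T u v \<and> \<not> T v u}"
  have T_if_dist_le: "T u v" if "dist_le D n u v" "n \<le> 4" "u \<in> verts D" "u \<noteq> v" for u v n
    using colored_path_if_dist_le[OF that(1,3,4), of c] that(2) assms(5)
    unfolding T_def by (meson le_trans)
  have A: "dist_le D 2 u v" "\<not> dist_le D 4 v u" if "(u, v) \<in> ?A" for u v
  proof -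
    have "v \<noteq> u" using that by auto
    then show "\<not> dist_le D 4 v u" using T_if_dist_le[of 4 v u] that by auto
    moreover have "(u, v) \<in> (arcs_ends D)\<^sup>*"
      using that rtrancl_if_colored_path unfolding T_def by blast
    ultimately show "dist_le D 2 u v"
      using dist_le_two_or_back_dist_le_four[OF assms(4)] by blast
  qed
  have walk: "dist_le D 2 x y" if "(x, y) \<in> ?A\<^sup>*" for x y
    using that
  proof (induction rule: rtrancl_induct)
    case base
    show ?case by (rule dist_le_refl)
  next
    case (step y z)
    show ?case
      using dist_le_two_step[OF assms(4) step.IH] A[OF step.hyps(2)] by blast
  qed
  have "acyclic ?A"
    unfolding acyclic_def
  proof (intro allI notI)
    fix x
    assume "(x, x) \<in> ?A\<^sup>+"
    then obtain y where xy: "(x, y) \<in> ?A\<^sup>*" and yx: "(y, x) \<in> ?A"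
      by (meson tranclD2)
    then have "T x y"
      using T_if_dist_le[OF walk[OF xy]] by auto
    then show False using yx by auto
  qed
  then obtain K where K: "K \<subseteq> verts D" "\<forall>u \<in> verts D - K. \<exists>v \<in> K. T u v"
    "\<forall>u \<in> K. \<forall>v \<in> K. u \<noteq> v \<longrightarrow> \<not> T u v"
    using kernel_if_acyclic_asymmetric_part[OF finite_verts, of T] by blast
  moreover have "K \<noteq> {}" using K(2) assms(2) by auto
  ultimately have "colored_kernel D c k K"
    unfolding colored_kernel_def colored_absorbent_def colored_independent_def T_def by blast
  then show ?thesis by blast
qed

end
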